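(* Every formula provable in $\mathsf{ATC}+(\mathrm{Df}.P_F)+(\mathrm{Df}.A_F)$ is provable in $\mathsf{AEM}_{\mathsf{pl}}+(\mathrm{Df}.aa_P)+(\mathrm{Df}.\mathfrak{at}^{ind}_P)+(\mathrm{Df}.\mathfrak{at}^{pl}_P)$, i.e. $\mathsf{ATC}+(\mathrm{Df}.P_F)+(\mathrm{Df}.A_F)\subseteq\mathsf{AEM}_{\mathsf{pl}}+(\mathrm{Df}.aa_P)+(\mathrm{Df}.\mathfrak{at}^{ind}_P)+(\mathrm{Df}.\mathfrak{at}^{pl}_P)$.
   Context: Language: two-sorted classical logic with individual variables $x,y,z,\dots$ and plural variables $xx,yy,zz,\dots$; identity $=$ between individual terms; the predicate $x\prec tt$ ("$x$ is one of $tt$"), individual on the left, plural term on the right. Abbreviations: $tt\preccurlyeq ss := \forall z(z\prec tt\to z\prec ss)\land \exists x(x\prec tt)$; $tt\approx ss := \forall x(x\prec tt\leftrightarrow x\prec ss)$; $\forall_{z\prec tt}\varphi:=\forall z(z\prec tt\to\varphi)$, $\exists_{z\prec tt}\varphi:=\exists z(z\prec tt\land\varphi)$, $\forall_{yy\preccurlyeq tt}\varphi:=\forall yy(yy\preccurlyeq tt\to\varphi)$, $\exists_{yy\preccurlyeq tt}\varphi:=\exists yy(yy\preccurlyeq tt\land\varphi)$. No plural comprehension schema is assumed and plurals may be empty. All axioms below are universally closed. $\mathsf{ATC}$: single non-logical primitive $F$, written $F_{tt}x$ ("$x$ is a composition of $tt$"); plural terms are plural variables, a constant $aa$, and $\mathfrak{at}_{tt}$.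 Axioms: $x\prec aa\leftrightarrow \forall yy\,\forall_{z\prec yy}(F_{yy}x\to z=x)$; $x\prec \mathfrak{at}_{zz}\leftrightarrow \exists_{y\prec zz}\exists_{yy\preccurlyeq aa}(F_{yy}y\land x\prec yy)$; (ATC1) $\forall x\,\exists_{zz\preccurlyeq aa}\big(F_{zz}x\land \forall_{yy\preccurlyeq aa}(F_{yy}x\leftrightarrow zz\approx yy)\land\forall y(F_{zz}y\to x=y)\big)$; (ATC2) $F_{zz}x\leftrightarrow F_{\mathfrak{at}_{zz}}x$. Using (ATC1), $\mathsf{ATC}$ is extended by plural terms $\mathfrak{at}_x$ characterized by $\mathfrak{at}_{x}\preccurlyeq aa \land F_{\mathfrak{at}_{x}}x \land \forall_{yy\preccurlyeq aa}(F_{yy}x\leftrightarrow yy\approx\mathfrak{at}_{x})\land \forall y (F_{\mathfrak{at}_{x}}y\to x=y)$. (Df.$P_F$): $Pxy\leftrightarrow\mathfrak{at}_x\preccurlyeq\mathfrak{at}_y$; (Df.$A_F$): $Ax\leftrightarrow x\prec aa$. $\mathsf{AEM}_{\mathsf{pl}}$: primitive binary predicate $P$ ("is a part of"), $Oxy:=\exists z(Pzx\land Pzy)$; axioms $Pxx$; $Pxy\land Pyz\to Pxz$; $Pxy\land Pyx\to x=y$; $\neg Pxy\to\exists z(Pzx\land\neg Ozy)$; definitions $Ax\leftrightarrow\forall y(Pyx\to x=y)$ and $F_{tt}x\leftrightarrow \forall_{z\prec tt}Pzx\land\forall y(Pyx\to\exists_{z\prec tt}Ozy)$; atomicity axiom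 $\forall x\exists y(Pyx\land Ay)$. (Df.$aa_P$): $x\prec aa\leftrightarrow Ax$; (Df.$\mathfrak{at}^{ind}_P$): $y\prec\mathfrak{at}_x\leftrightarrow Pyx\land y\prec aa$; (Df.$\mathfrak{at}^{pl}_P$): $y\prec\mathfrak{at}_{xx}\leftrightarrow\exists z(z\prec xx\land Pyz\land y\prec aa)$. In the inclusion, the symbols $F,aa,\mathfrak{at}_{tt},\mathfrak{at}_x,P,A$ are read in $\mathsf{AEM}_{\mathsf{pl}}$ via its primitive $P$ and the definitions above. *)

theory Defs
  imports Main
begin

type_synonym ivar = nat
type_synonym pvar = nat

text \<open>
  The two sorts have separate, countably infinite supplies of variables.  The only individual
  terms are individual variables.  Plural terms carry two distinct operators for the two uses of
  the symbol ``at'': one takes a plural term, the other an individual.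
\<close>

datatype pterm =
    PVar pvar
  | AA
  | AtP pterm
  | AtI ivar

datatype fm =
    Eq ivar ivar      (infix \<open>\<^bold>=\<close> 70)
  | Mem ivar pterm    (infix \<open>\<^bold>\<prec>\<close> 70)
  | Fus pterm ivar
  | Part ivar ivar
  | Atom ivar
  | Bot               (\<open>\<^bold>\<bottom>\<close>)
  | Imp fm fm         (infixr \<open>\<^bold>\<longrightarrow>\<close> 55)
  | And fm fm         (infixr \<open>\<^bold>\<and>\<close> 65)
  | Or fm fm          (infixr \<open>\<^bold>\<or>\<close> 60)
  | AllI ivar fm      (\<open>(\<^bold>\<forall>\<^sub>i_./ _)\<close> [1000, 50] 50)
  | ExI ivar fm       (\<open>(\<^bold>\<exists>\<^sub>i_./ _)\<close> [1000, 50] 50)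
  | AllP pvar fm      (\<open>(\<^bold>\<forall>\<^sub>p_./ _)\<close> [1000, 50] 50)
  | ExP pvar fm       (\<open>(\<^bold>\<exists>\<^sub>p_./ _)\<close> [1000, 50] 50)

abbreviation Neg :: "fm \<Rightarrow> fm" (\<open>\<^bold>\<not> _\<close> [68] 68) where
  "\<^bold>\<not> \<phi> \<equiv> \<phi> \<^bold>\<longrightarrow> \<^bold>\<bottom>"

abbreviation Iff :: "fm \<Rightarrow> fm \<Rightarrow> fm" (infix \<open>\<^bold>\<longleftrightarrow>\<close> 53) where
  "\<phi> \<^bold>\<longleftrightarrow> \<psi> \<equiv> (\<phi> \<^bold>\<longrightarrow> \<psi>) \<^bold>\<and> (\<psi> \<^bold>\<longrightarrow> \<phi>)"


subsection \<open>Free variables and substitution\<close>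

primrec ivars_t :: "pterm \<Rightarrow> ivar set" where
  "ivars_t (PVar v) = {}"
| "ivars_t AA = {}"
| "ivars_t (AtP t) = ivars_t t"
| "ivars_t (AtI x) = {x}"

primrec pvars_t :: "pterm \<Rightarrow> pvar set" where
  "pvars_t (PVar v) = {v}"
| "pvars_t AA = {}"
| "pvars_t (AtP t) = pvars_t t"
| "pvars_t (AtI x) = {}"

primrec ifree :: "fm \<Rightarrow> ivar set" where
  "ifree (x \<^bold>= y) = {x, y}"
| "ifree (x \<^bold>\<prec> t) = insert x (ivars_t t)"
| "ifree (Fus t x) = insert x (ivars_t t)"
| "ifree (Part x y) = {x, y}"
| "ifree (Atom x) = {x}"
| "ifree \<^bold>\<bottom> = {}"
| "ifree (\<phi> \<^bold>\<longrightarrow> \<psi>) = ifree \<phi> \<union> ifree \<psi>"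
| "ifree (\<phi> \<^bold>\<and> \<psi>) = ifree \<phi> \<union> ifree \<psi>"
| "ifree (\<phi> \<^bold>\<or> \<psi>) = ifree \<phi> \<union> ifree \<psi>"
| "ifree (\<^bold>\<forall>\<^sub>i z. \<phi>) = ifree \<phi> - {z}"
| "ifree (\<^bold>\<exists>\<^sub>i z. \<phi>) = ifree \<phi> - {z}"
| "ifree (\<^bold>\<forall>\<^sub>p v. \<phi>) = ifree \<phi>"
| "ifree (\<^bold>\<exists>\<^sub>p v. \<phi>) = ifree \<phi>"

primrec pfree :: "fm \<Rightarrow> pvar set" where
  "pfree (x \<^bold>= y) = {}"
| "pfree (x \<^bold>\<prec> t) = pvars_t t"
| "pfree (Fus t x) = pvars_t t"
| "pfree (Part x y) = {}"
| "pfree (Atom x) = {}"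
| "pfree \<^bold>\<bottom> = {}"
| "pfree (\<phi> \<^bold>\<longrightarrow> \<psi>) = pfree \<phi> \<union> pfree \<psi>"
| "pfree (\<phi> \<^bold>\<and> \<psi>) = pfree \<phi> \<union> pfree \<psi>"
| "pfree (\<phi> \<^bold>\<or> \<psi>) = pfree \<phi> \<union> pfree \<psi>"
| "pfree (\<^bold>\<forall>\<^sub>i z. \<phi>) = pfree \<phi>"
| "pfree (\<^bold>\<exists>\<^sub>i z. \<phi>) = pfree \<phi>"
| "pfree (\<^bold>\<forall>\<^sub>p v. \<phi>) = pfree \<phi> - {v}"
| "pfree (\<^bold>\<exists>\<^sub>p v. \<phi>) = pfree \<phi> - {v}"

definition isub_v :: "ivar \<Rightarrow> ivar \<Rightarrow> ivar \<Rightarrow> ivar" where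
  "isub_v x y z = (if z = x then y else z)"

primrec isub_t :: "ivar \<Rightarrow> ivar \<Rightarrow> pterm \<Rightarrow> pterm" where
  "isub_t x y (PVar v) = PVar v"
| "isub_t x y AA = AA"
| "isub_t x y (AtP t) = AtP (isub_t x y t)"
| "isub_t x y (AtI z) = AtI (isub_v x y z)"

primrec psub_t :: "pvar \<Rightarrow> pterm \<Rightarrow> pterm \<Rightarrow> pterm" where
  "psub_t u s (PVar v) = (if v = u then s else PVar v)"
| "psub_t u s AA = AA"
| "psub_t u s (AtP t) = AtP (psub_t u s t)"
| "psub_t u s (AtI z) = AtI z"

text \<open>
  \<open>isub x y \<phi>\<close> replaces the free occurrences of \<open>x\<close> in \<open>\<phi>\<close> by \<open>y\<close>, and \<open>psub u s \<phi>\<close> those of the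
  plural variable \<open>u\<close> by the plural term \<open>s\<close>.  Neither renames bound variables; capture is
  excluded by the side conditions \<open>isubst_ok\<close> and \<open>psubst_ok\<close> (``\<open>y\<close> is free for \<open>x\<close> in \<open>\<phi>\<close>'').
  A plural term may contain individual variables, so individual quantifiers can capture too in
  the plural case.
\<close>

primrec isub :: "ivar \<Rightarrow> ivar \<Rightarrow> fm \<Rightarrow> fm" where
  "isub x y (a \<^bold>= b) = (isub_v x y a \<^bold>= isub_v x y b)"
| "isub x y (a \<^bold>\<prec> t) = (isub_v x y a \<^bold>\<prec> isub_t x y t)"
| "isub x y (Fus t a) = Fus (isub_t x y t) (isub_v x y a)"
| "isub x y (Part a b) = Part (isub_v x y a) (isub_v x y b)"
| "isub x y (Atom a) = Atom (isub_v x y a)"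
| "isub x y \<^bold>\<bottom> = \<^bold>\<bottom>"
| "isub x y (\<phi> \<^bold>\<longrightarrow> \<psi>) = (isub x y \<phi> \<^bold>\<longrightarrow> isub x y \<psi>)"
| "isub x y (\<phi> \<^bold>\<and> \<psi>) = (isub x y \<phi> \<^bold>\<and> isub x y \<psi>)"
| "isub x y (\<phi> \<^bold>\<or> \<psi>) = (isub x y \<phi> \<^bold>\<or> isub x y \<psi>)"
| "isub x y (\<^bold>\<forall>\<^sub>i z. \<phi>) = (\<^bold>\<forall>\<^sub>i z. (if z = x then \<phi> else isub x y \<phi>))"
| "isub x y (\<^bold>\<exists>\<^sub>i z. \<phi>) = (\<^bold>\<exists>\<^sub>i z. (if z = x then \<phi> else isub x y \<phi>))"
| "isub x y (\<^bold>\<forall>\<^sub>p v. \<phi>) = (\<^bold>\<forall>\<^sub>p v. isub x y \<phi>)"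
| "isub x y (\<^bold>\<exists>\<^sub>p v. \<phi>) = (\<^bold>\<exists>\<^sub>p v. isub x y \<phi>)"

primrec psub :: "pvar \<Rightarrow> pterm \<Rightarrow> fm \<Rightarrow> fm" where
  "psub u s (a \<^bold>= b) = (a \<^bold>= b)"
| "psub u s (a \<^bold>\<prec> t) = (a \<^bold>\<prec> psub_t u s t)"
| "psub u s (Fus t a) = Fus (psub_t u s t) a"
| "psub u s (Part a b) = Part a b"
| "psub u s (Atom a) = Atom a"
| "psub u s \<^bold>\<bottom> = \<^bold>\<bottom>"
| "psub u s (\<phi> \<^bold>\<longrightarrow> \<psi>) = (psub u s \<phi> \<^bold>\<longrightarrow> psub u s \<psi>)"
| "psub u s (\<phi> \<^bold>\<and> \<psi>) = (psub u s \<phi> \<^bold>\<and> psub u s \<psi>)"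
| "psub u s (\<phi> \<^bold>\<or> \<psi>) = (psub u s \<phi> \<^bold>\<or> psub u s \<psi>)"
| "psub u s (\<^bold>\<forall>\<^sub>i z. \<phi>) = (\<^bold>\<forall>\<^sub>i z. psub u s \<phi>)"
| "psub u s (\<^bold>\<exists>\<^sub>i z. \<phi>) = (\<^bold>\<exists>\<^sub>i z. psub u s \<phi>)"
| "psub u s (\<^bold>\<forall>\<^sub>p v. \<phi>) = (\<^bold>\<forall>\<^sub>p v. (if v = u then \<phi> else psub u s \<phi>))"
| "psub u s (\<^bold>\<exists>\<^sub>p v. \<phi>) = (\<^bold>\<exists>\<^sub>p v. (if v = u then \<phi> else psub u s \<phi>))"

primrec isubst_ok :: "ivar \<Rightarrow> ivar \<Rightarrow> fm \<Rightarrow> bool" where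
  "isubst_ok x y (a \<^bold>= b) \<longleftrightarrow> True"
| "isubst_ok x y (a \<^bold>\<prec> t) \<longleftrightarrow> True"
| "isubst_ok x y (Fus t a) \<longleftrightarrow> True"
| "isubst_ok x y (Part a b) \<longleftrightarrow> True"
| "isubst_ok x y (Atom a) \<longleftrightarrow> True"
| "isubst_ok x y \<^bold>\<bottom> \<longleftrightarrow> True"
| "isubst_ok x y (\<phi> \<^bold>\<longrightarrow> \<psi>) \<longleftrightarrow> isubst_ok x y \<phi> \<and> isubst_ok x y \<psi>"
| "isubst_ok x y (\<phi> \<^bold>\<and> \<psi>) \<longleftrightarrow> isubst_ok x y \<phi> \<and> isubst_ok x y \<psi>"
| "isubst_ok x y (\<phi> \<^bold>\<or> \<psi>) \<longleftrightarrow> isubst_ok x y \<phi> \<and> isubst_ok x y \<psi>"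
| "isubst_ok x y (\<^bold>\<forall>\<^sub>i z. \<phi>) \<longleftrightarrow> x \<notin> ifree \<phi> - {z} \<or> (y \<noteq> z \<and> isubst_ok x y \<phi>)"
| "isubst_ok x y (\<^bold>\<exists>\<^sub>i z. \<phi>) \<longleftrightarrow> x \<notin> ifree \<phi> - {z} \<or> (y \<noteq> z \<and> isubst_ok x y \<phi>)"
| "isubst_ok x y (\<^bold>\<forall>\<^sub>p v. \<phi>) \<longleftrightarrow> isubst_ok x y \<phi>"
| "isubst_ok x y (\<^bold>\<exists>\<^sub>p v. \<phi>) \<longleftrightarrow> isubst_ok x y \<phi>"

primrec psubst_ok :: "pvar \<Rightarrow> pterm \<Rightarrow> fm \<Rightarrow> bool" where
  "psubst_ok u s (a \<^bold>= b) \<longleftrightarrow> True"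
| "psubst_ok u s (a \<^bold>\<prec> t) \<longleftrightarrow> True"
| "psubst_ok u s (Fus t a) \<longleftrightarrow> True"
| "psubst_ok u s (Part a b) \<longleftrightarrow> True"
| "psubst_ok u s (Atom a) \<longleftrightarrow> True"
| "psubst_ok u s \<^bold>\<bottom> \<longleftrightarrow> True"
| "psubst_ok u s (\<phi> \<^bold>\<longrightarrow> \<psi>) \<longleftrightarrow> psubst_ok u s \<phi> \<and> psubst_ok u s \<psi>"
| "psubst_ok u s (\<phi> \<^bold>\<and> \<psi>) \<longleftrightarrow> psubst_ok u s \<phi> \<and> psubst_ok u s \<psi>"
| "psubst_ok u s (\<phi> \<^bold>\<or> \<psi>) \<longleftrightarrow> psubst_ok u s \<phi> \<and> psubst_ok u s \<psi>"
| "psubst_ok u s (\<^bold>\<forall>\<^sub>i z. \<phi>) \<longleftrightarrow> u \<notin> pfree \<phi> \<or> (z \<notin> ivars_t s \<and> psubst_ok u s \<phi>)"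
| "psubst_ok u s (\<^bold>\<exists>\<^sub>i z. \<phi>) \<longleftrightarrow> u \<notin> pfree \<phi> \<or> (z \<notin> ivars_t s \<and> psubst_ok u s \<phi>)"
| "psubst_ok u s (\<^bold>\<forall>\<^sub>p v. \<phi>) \<longleftrightarrow> u \<notin> pfree \<phi> - {v} \<or> (v \<notin> pvars_t s \<and> psubst_ok u s \<phi>)"
| "psubst_ok u s (\<^bold>\<exists>\<^sub>p v. \<phi>) \<longleftrightarrow> u \<notin> pfree \<phi> - {v} \<or> (v \<notin> pvars_t s \<and> psubst_ok u s \<phi>)"


subsection \<open>Provability\<close>

text \<open>
  Classical two-sorted natural deduction with identity between individuals.  In particular there
  is no comprehension rule for plurals, no rule making plurals nonempty, and no rule
  identifying coextensive plurals.  In the quantifier rules the eigenvariable \<open>y\<close> (or \<open>v\<close>) may,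
  but need not, be the bound variable itself.
\<close>

inductive proves :: "fm set \<Rightarrow> fm \<Rightarrow> bool" (infix \<open>\<turnstile>\<close> 40) where
  Assm: "\<phi> \<in> \<Gamma> \<Longrightarrow> \<Gamma> \<turnstile> \<phi>"
| ImpI: "insert \<phi> \<Gamma> \<turnstile> \<psi> \<Longrightarrow> \<Gamma> \<turnstile> \<phi> \<^bold>\<longrightarrow> \<psi>"
| ImpE: "\<Gamma> \<turnstile> \<phi> \<^bold>\<longrightarrow> \<psi> \<Longrightarrow> \<Gamma> \<turnstile> \<phi> \<Longrightarrow> \<Gamma> \<turnstile> \<psi>"
| AndI: "\<Gamma> \<turnstile> \<phi> \<Longrightarrow> \<Gamma> \<turnstile> \<psi> \<Longrightarrow> \<Gamma> \<turnstile> \<phi> \<^bold>\<and> \<psi>"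
| AndE1: "\<Gamma> \<turnstile> \<phi> \<^bold>\<and> \<psi> \<Longrightarrow> \<Gamma> \<turnstile> \<phi>"
| AndE2: "\<Gamma> \<turnstile> \<phi> \<^bold>\<and> \<psi> \<Longrightarrow> \<Gamma> \<turnstile> \<psi>"
| OrI1: "\<Gamma> \<turnstile> \<phi> \<Longrightarrow> \<Gamma> \<turnstile> \<phi> \<^bold>\<or> \<psi>"
| OrI2: "\<Gamma> \<turnstile> \<psi> \<Longrightarrow> \<Gamma> \<turnstile> \<phi> \<^bold>\<or> \<psi>"
| OrE: "\<Gamma> \<turnstile> \<phi> \<^bold>\<or> \<psi> \<Longrightarrow> insert \<phi> \<Gamma> \<turnstile> \<chi> \<Longrightarrow> insert \<psi> \<Gamma> \<turnstile> \<chi> \<Longrightarrow> \<Gamma> \<turnstile> \<chi>"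
| Class: "insert (\<^bold>\<not> \<phi>) \<Gamma> \<turnstile> \<^bold>\<bottom> \<Longrightarrow> \<Gamma> \<turnstile> \<phi>"
| AllI_I: "\<Gamma> \<turnstile> isub x y \<phi> \<Longrightarrow> isubst_ok x y \<phi> \<Longrightarrow>
    y \<notin> ifree (\<^bold>\<forall>\<^sub>i x. \<phi>) \<Longrightarrow> \<forall>\<gamma>\<in>\<Gamma>. y \<notin> ifree \<gamma> \<Longrightarrow> \<Gamma> \<turnstile> \<^bold>\<forall>\<^sub>i x. \<phi>"
| AllI_E: "\<Gamma> \<turnstile> \<^bold>\<forall>\<^sub>i x. \<phi> \<Longrightarrow> isubst_ok x y \<phi> \<Longrightarrow> \<Gamma> \<turnstile> isub x y \<phi>"
| ExI_I: "\<Gamma> \<turnstile> isub x y \<phi> \<Longrightarrow> isubst_ok x y \<phi> \<Longrightarrow> \<Gamma> \<turnstile> \<^bold>\<exists>\<^sub>i x. \<phi>"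
| ExI_E: "\<Gamma> \<turnstile> \<^bold>\<exists>\<^sub>i x. \<phi> \<Longrightarrow> insert (isub x y \<phi>) \<Gamma> \<turnstile> \<psi> \<Longrightarrow> isubst_ok x y \<phi> \<Longrightarrow>
    y \<notin> ifree (\<^bold>\<exists>\<^sub>i x. \<phi>) \<Longrightarrow> y \<notin> ifree \<psi> \<Longrightarrow> \<forall>\<gamma>\<in>\<Gamma>. y \<notin> ifree \<gamma> \<Longrightarrow> \<Gamma> \<turnstile> \<psi>"
| AllP_I: "\<Gamma> \<turnstile> psub u (PVar v) \<phi> \<Longrightarrow> psubst_ok u (PVar v) \<phi> \<Longrightarrow>
    v \<notin> pfree (\<^bold>\<forall>\<^sub>p u. \<phi>) \<Longrightarrow> \<forall>\<gamma>\<in>\<Gamma>. v \<notin> pfree \<gamma> \<Longrightarrow> \<Gamma> \<turnstile> \<^bold>\<forall>\<^sub>p u. \<phi>"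
| AllP_E: "\<Gamma> \<turnstile> \<^bold>\<forall>\<^sub>p u. \<phi> \<Longrightarrow> psubst_ok u t \<phi> \<Longrightarrow> \<Gamma> \<turnstile> psub u t \<phi>"
| ExP_I: "\<Gamma> \<turnstile> psub u t \<phi> \<Longrightarrow> psubst_ok u t \<phi> \<Longrightarrow> \<Gamma> \<turnstile> \<^bold>\<exists>\<^sub>p u. \<phi>"
| ExP_E: "\<Gamma> \<turnstile> \<^bold>\<exists>\<^sub>p u. \<phi> \<Longrightarrow> insert (psub u (PVar v) \<phi>) \<Gamma> \<turnstile> \<psi> \<Longrightarrow> psubst_ok u (PVar v) \<phi> \<Longrightarrow>
    v \<notin> pfree (\<^bold>\<exists>\<^sub>p u. \<phi>) \<Longrightarrow> v \<notin> pfree \<psi> \<Longrightarrow> \<forall>\<gamma>\<in>\<Gamma>. v \<notin> pfree \<gamma> \<Longrightarrow> \<Gamma> \<turnstile> \<psi>"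
| EqRefl: "\<Gamma> \<turnstile> x \<^bold>= x"
| EqSubst: "\<Gamma> \<turnstile> x \<^bold>= y \<Longrightarrow> \<Gamma> \<turnstile> isub z x \<phi> \<Longrightarrow> isubst_ok z x \<phi> \<Longrightarrow> isubst_ok z y \<phi> \<Longrightarrow>
    \<Gamma> \<turnstile> isub z y \<phi>"


subsection \<open>Abbreviations of the object language\<close>

text \<open>All individual variables of \<open>t\<close> lie strictly below \<open>ifresh_t t\<close>.\<close>

primrec ifresh_t :: "pterm \<Rightarrow> ivar" where
  "ifresh_t (PVar v) = 0"
| "ifresh_t AA = 0"
| "ifresh_t (AtP t) = ifresh_t t"
| "ifresh_t (AtI x) = Suc x"

definition SubP :: "pterm \<Rightarrow> pterm \<Rightarrow> fm" (infix \<open>\<^bold>\<preceq>\<close> 70) where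
  "t \<^bold>\<preceq> s = (let z = max (ifresh_t t) (ifresh_t s)
            in (\<^bold>\<forall>\<^sub>i z. (z \<^bold>\<prec> t \<^bold>\<longrightarrow> z \<^bold>\<prec> s)) \<^bold>\<and> (\<^bold>\<exists>\<^sub>i z. z \<^bold>\<prec> t))"

definition Coext :: "pterm \<Rightarrow> pterm \<Rightarrow> fm" (infix \<open>\<^bold>\<approx>\<close> 70) where
  "t \<^bold>\<approx> s = (let z = max (ifresh_t t) (ifresh_t s)
            in \<^bold>\<forall>\<^sub>i z. (z \<^bold>\<prec> t \<^bold>\<longleftrightarrow> z \<^bold>\<prec> s))"

definition Overlap :: "ivar \<Rightarrow> ivar \<Rightarrow> fm" where
  "Overlap x y = (let z = Suc (max x y) in \<^bold>\<exists>\<^sub>i z. (Part z x \<^bold>\<and> Part z y))"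

abbreviation AllMem :: "ivar \<Rightarrow> pterm \<Rightarrow> fm \<Rightarrow> fm" (\<open>(\<^bold>\<forall>\<^sub>i_\<^bold>\<prec>_./ _)\<close> [1000, 71, 50] 50) where
  "\<^bold>\<forall>\<^sub>i z\<^bold>\<prec>t. \<phi> \<equiv> \<^bold>\<forall>\<^sub>i z. (z \<^bold>\<prec> t \<^bold>\<longrightarrow> \<phi>)"

abbreviation ExMem :: "ivar \<Rightarrow> pterm \<Rightarrow> fm \<Rightarrow> fm" (\<open>(\<^bold>\<exists>\<^sub>i_\<^bold>\<prec>_./ _)\<close> [1000, 71, 50] 50) where
  "\<^bold>\<exists>\<^sub>i z\<^bold>\<prec>t. \<phi> \<equiv> \<^bold>\<exists>\<^sub>i z. (z \<^bold>\<prec> t \<^bold>\<and> \<phi>)"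

abbreviation AllSubP :: "pvar \<Rightarrow> pterm \<Rightarrow> fm \<Rightarrow> fm" (\<open>(\<^bold>\<forall>\<^sub>p_\<^bold>\<preceq>_./ _)\<close> [1000, 71, 50] 50) where
  "\<^bold>\<forall>\<^sub>p v\<^bold>\<preceq>t. \<phi> \<equiv> \<^bold>\<forall>\<^sub>p v. (PVar v \<^bold>\<preceq> t \<^bold>\<longrightarrow> \<phi>)"

abbreviation ExSubP :: "pvar \<Rightarrow> pterm \<Rightarrow> fm \<Rightarrow> fm" (\<open>(\<^bold>\<exists>\<^sub>p_\<^bold>\<preceq>_./ _)\<close> [1000, 71, 50] 50) where
  "\<^bold>\<exists>\<^sub>p v\<^bold>\<preceq>t. \<phi> \<equiv> \<^bold>\<exists>\<^sub>p v. (PVar v \<^bold>\<preceq> t \<^bold>\<and> \<phi>)"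

abbreviation (input) vx :: ivar where "vx \<equiv> 0"
abbreviation (input) vy :: ivar where "vy \<equiv> 1"
abbreviation (input) vz :: ivar where "vz \<equiv> 2"
abbreviation (input) vxx :: pvar where "vxx \<equiv> 0"
abbreviation (input) vyy :: pvar where "vyy \<equiv> 1"
abbreviation (input) vzz :: pvar where "vzz \<equiv> 2"


subsection \<open>Atomistic composition theory\<close>

definition Ax_aa_F :: fm where
  "Ax_aa_F = (\<^bold>\<forall>\<^sub>i vx. (vx \<^bold>\<prec> AA \<^bold>\<longleftrightarrow>
     (\<^bold>\<forall>\<^sub>p vyy. \<^bold>\<forall>\<^sub>i vz\<^bold>\<prec>PVar vyy. (Fus (PVar vyy) vx \<^bold>\<longrightarrow> vz \<^bold>= vx))))"

definition Ax_at_F :: fm where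
  "Ax_at_F = (\<^bold>\<forall>\<^sub>i vx. \<^bold>\<forall>\<^sub>p vzz. (vx \<^bold>\<prec> AtP (PVar vzz) \<^bold>\<longleftrightarrow>
     (\<^bold>\<exists>\<^sub>i vy\<^bold>\<prec>PVar vzz. \<^bold>\<exists>\<^sub>p vyy\<^bold>\<preceq>AA. (Fus (PVar vyy) vy \<^bold>\<and> vx \<^bold>\<prec> PVar vyy))))"

definition ATC1 :: fm where
  "ATC1 = (\<^bold>\<forall>\<^sub>i vx. \<^bold>\<exists>\<^sub>p vzz\<^bold>\<preceq>AA. (Fus (PVar vzz) vx
     \<^bold>\<and> (\<^bold>\<forall>\<^sub>p vyy\<^bold>\<preceq>AA. (Fus (PVar vyy) vx \<^bold>\<longleftrightarrow> PVar vzz \<^bold>\<approx> PVar vyy))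
     \<^bold>\<and> (\<^bold>\<forall>\<^sub>i vy. (Fus (PVar vzz) vy \<^bold>\<longrightarrow> vx \<^bold>= vy))))"

definition ATC2 :: fm where
  "ATC2 = (\<^bold>\<forall>\<^sub>p vzz. \<^bold>\<forall>\<^sub>i vx. (Fus (PVar vzz) vx \<^bold>\<longleftrightarrow> Fus (AtP (PVar vzz)) vx))"

definition Ax_at_ind_F :: fm where
  "Ax_at_ind_F = (\<^bold>\<forall>\<^sub>i vx. (AtI vx \<^bold>\<preceq> AA \<^bold>\<and> Fus (AtI vx) vx
     \<^bold>\<and> (\<^bold>\<forall>\<^sub>p vyy\<^bold>\<preceq>AA. (Fus (PVar vyy) vx \<^bold>\<longleftrightarrow> PVar vyy \<^bold>\<approx> AtI vx))
     \<^bold>\<and> (\<^bold>\<forall>\<^sub>i vy. (Fus (AtI vx) vy \<^bold>\<longrightarrow> vx \<^bold>= vy))))"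

text \<open>
  \<open>ATC\<close> is taken with its extension by the terms \<open>AtI x\<close>, whose existence \<open>ATC1\<close> licenses and
  which \<open>Ax_at_ind_F\<close> characterizes.
\<close>

definition ATC :: "fm set" where
  "ATC = {Ax_aa_F, Ax_at_F, ATC1, ATC2, Ax_at_ind_F}"

definition Df_P_F :: fm where
  "Df_P_F = (\<^bold>\<forall>\<^sub>i vx. \<^bold>\<forall>\<^sub>i vy. (Part vx vy \<^bold>\<longleftrightarrow> AtI vx \<^bold>\<preceq> AtI vy))"

definition Df_A_F :: fm where
  "Df_A_F = (\<^bold>\<forall>\<^sub>i vx. (Atom vx \<^bold>\<longleftrightarrow> vx \<^bold>\<prec> AA))"


subsection \<open>Atomistic extensional mereology with plurals\<close>

definition P_refl :: fm where
  "P_refl = (\<^bold>\<forall>\<^sub>i vx. Part vx vx)"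

definition P_trans :: fm where
  "P_trans = (\<^bold>\<forall>\<^sub>i vx. \<^bold>\<forall>\<^sub>i vy. \<^bold>\<forall>\<^sub>i vz. (Part vx vy \<^bold>\<and> Part vy vz \<^bold>\<longrightarrow> Part vx vz))"

definition P_antisym :: fm where
  "P_antisym = (\<^bold>\<forall>\<^sub>i vx. \<^bold>\<forall>\<^sub>i vy. (Part vx vy \<^bold>\<and> Part vy vx \<^bold>\<longrightarrow> vx \<^bold>= vy))"

definition P_supplementation :: fm where
  "P_supplementation = (\<^bold>\<forall>\<^sub>i vx. \<^bold>\<forall>\<^sub>i vy.
     (\<^bold>\<not> Part vx vy \<^bold>\<longrightarrow> (\<^bold>\<exists>\<^sub>i vz. (Part vz vx \<^bold>\<and> \<^bold>\<not> Overlap vz vy))))"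

definition Df_A :: fm where
  "Df_A = (\<^bold>\<forall>\<^sub>i vx. (Atom vx \<^bold>\<longleftrightarrow> (\<^bold>\<forall>\<^sub>i vy. (Part vy vx \<^bold>\<longrightarrow> vx \<^bold>= vy))))"

definition Df_F :: fm where
  "Df_F = (\<^bold>\<forall>\<^sub>p vxx. \<^bold>\<forall>\<^sub>i vx. (Fus (PVar vxx) vx \<^bold>\<longleftrightarrow>
     (\<^bold>\<forall>\<^sub>i vz\<^bold>\<prec>PVar vxx. Part vz vx)
     \<^bold>\<and> (\<^bold>\<forall>\<^sub>i vy. (Part vy vx \<^bold>\<longrightarrow> (\<^bold>\<exists>\<^sub>i vz\<^bold>\<prec>PVar vxx. Overlap vz vy)))))"

definition P_atomicity :: fm where
  "P_atomicity = (\<^bold>\<forall>\<^sub>i vx. \<^bold>\<exists>\<^sub>i vy. (Part vy vx \<^bold>\<and> Atom vy))"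

definition AEM_pl :: "fm set" where
  "AEM_pl = {P_refl, P_trans, P_antisym, P_supplementation, Df_A, Df_F, P_atomicity}"

definition Df_aa_P :: fm where
  "Df_aa_P = (\<^bold>\<forall>\<^sub>i vx. (vx \<^bold>\<prec> AA \<^bold>\<longleftrightarrow> Atom vx))"

definition Df_at_ind_P :: fm where
  "Df_at_ind_P = (\<^bold>\<forall>\<^sub>i vx. \<^bold>\<forall>\<^sub>i vy. (vy \<^bold>\<prec> AtI vx \<^bold>\<longleftrightarrow> Part vy vx \<^bold>\<and> vy \<^bold>\<prec> AA))"

definition Df_at_pl_P :: fm where
  "Df_at_pl_P = (\<^bold>\<forall>\<^sub>p vxx. \<^bold>\<forall>\<^sub>i vy. (vy \<^bold>\<prec> AtP (PVar vxx) \<^bold>\<longleftrightarrow>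
     (\<^bold>\<exists>\<^sub>i vz. (vz \<^bold>\<prec> PVar vxx \<^bold>\<and> Part vy vz \<^bold>\<and> vy \<^bold>\<prec> AA))))"

end

theory Submission
  imports Defs "HOL-Library.Countable"
begin

text \<open>
  Every consistent finite set of formulas extends to a maximal consistent set \<open>\<Delta>\<close> in which all
  existential formulas are witnessed by variables.  Membership in \<open>\<Delta>\<close> commutes with the
  connectives and quantifiers, so the axioms of AEM in \<open>\<Delta>\<close> turn the variables and plural terms
  into a two-sorted structure.  There \<open>x\<close> fuses its atoms; by supplementation and atomicity, parthood
  is inclusion of atoms, so \<open>x\<close> is the only thing that these atoms compose.  Hence the axioms of
  ATC lie in every such \<open>\<Delta>\<close> and are derivable.  Since all axioms are closed, derivations from ATC
  can be cut against derivations from AEM.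
\<close>

section \<open>Freshness\<close>

lemma finite_ivars_t [simp]: "finite (ivars_t t)"
  by (induction t) auto

lemma finite_pvars_t [simp]: "finite (pvars_t t)"
  by (induction t) auto

lemma finite_ifree [simp]: "finite (ifree \<phi>)"
  by (induction \<phi>) auto

lemma finite_pfree [simp]: "finite (pfree \<phi>)"
  by (induction \<phi>) auto

text \<open>Only a variable bound somewhere in \<phi> can be captured. In a quantifier case the
  unsuitable variables are those of the body and possibly the bound variable.\<close>

lemma finite_not_isubst_ok: "finite {y. \<not> isubst_ok x y \<phi>}"
proof (induction \<phi>)
  case (AllI z \<phi>)
  show ?case by (rule finite_subset[OF _ finite.insertI[OF AllI, of z]]) auto
next
  case (ExI z \<phi>)
  show ?case by (rule finite_subset[OF _ finite.insertI[OF ExI, of z]]) auto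
qed (auto simp: Collect_disj_eq simp del: disj_not1)

lemma finite_not_psubst_ok: "finite {v. \<not> psubst_ok u (PVar v) \<phi>}"
proof (induction \<phi>)
  case (AllP z \<phi>)
  show ?case by (rule finite_subset[OF _ finite.insertI[OF AllP, of z]]) auto
next
  case (ExP z \<phi>)
  show ?case by (rule finite_subset[OF _ finite.insertI[OF ExP, of z]]) auto
qed (auto simp: Collect_disj_eq simp del: disj_not1)

lemma exists_shift_notin:
  assumes "finite (X :: nat set)"
  shows "\<exists>y. y + k \<notin> X"
proof -
  obtain b where "\<forall>x\<in>X. x < b"
    using assms finite_nat_set_iff_bounded by auto
  then have "b + k \<notin> X" by auto
  then show ?thesis by blast
qed

text \<open>The form \<open>y + k\<close> is wanted because witnesses in a saturated set have to
  avoid the first \<open>k\<close> variables.\<close>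

lemma exists_fresh_ivar:
  assumes "finite \<Gamma>"
  obtains y where "isubst_ok x (y + k) \<phi>" "y + k \<notin> ifree \<phi>" "\<forall>\<gamma>\<in>\<Gamma>. y + k \<notin> ifree \<gamma>"
proof -
  have "finite ({y. \<not> isubst_ok x y \<phi>} \<union> ifree \<phi> \<union> (\<Union>\<gamma>\<in>\<Gamma>. ifree \<gamma>))"
    using assms finite_not_isubst_ok by auto
  from exists_shift_notin[OF this, of k] show thesis using that by auto
qed

lemma exists_fresh_pvar:
  assumes "finite \<Gamma>"
  obtains v where "psubst_ok u (PVar (v + k)) \<phi>" "v + k \<notin> pfree \<phi>" "\<forall>\<gamma>\<in>\<Gamma>. v + k \<notin> pfree \<gamma>"
proof -
  have "finite ({v. \<not> psubst_ok u (PVar v) \<phi>} \<union> pfree \<phi> \<union> (\<Union>\<gamma>\<in>\<Gamma>. pfree \<gamma>))"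
    using assms finite_not_psubst_ok by auto
  from exists_shift_notin[OF this, of k] show thesis using that by auto
qed


section \<open>Saturated extensions\<close>

text \<open>
  Weakening by formulas that contain an eigenvariable is not directly available for
  \<open>\<turnstile>\<close>; quantifying over all finite supersets builds it in, while every rule of the
  calculus survives because a fresh eigenvariable can be chosen for each superset.
\<close>

definition stably_proves :: "fm set \<Rightarrow> fm \<Rightarrow> bool" (infix \<open>\<tturnstile>\<close> 40) where
  "\<Gamma> \<tturnstile> \<phi> \<longleftrightarrow> (\<forall>\<Gamma>'. finite \<Gamma>' \<longrightarrow> \<Gamma> \<subseteq> \<Gamma>' \<longrightarrow> \<Gamma>' \<turnstile> \<phi>)"

lemma stably_provesI: "(\<And>\<Gamma>'. finite \<Gamma>' \<Longrightarrow> \<Gamma> \<subseteq> \<Gamma>' \<Longrightarrow> \<Gamma>' \<turnstile> \<phi>) \<Longrightarrow> \<Gamma> \<tturnstile> \<phi>"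
  by (simp add: stably_proves_def)

lemma stably_provesD: "\<Gamma> \<tturnstile> \<phi> \<Longrightarrow> finite \<Gamma>' \<Longrightarrow> \<Gamma> \<subseteq> \<Gamma>' \<Longrightarrow> \<Gamma>' \<turnstile> \<phi>"
  by (simp add: stably_proves_def)

lemma stably_proves_mono: "\<Gamma> \<tturnstile> \<phi> \<Longrightarrow> \<Gamma> \<subseteq> \<Gamma>' \<Longrightarrow> \<Gamma>' \<tturnstile> \<phi>"
  unfolding stably_proves_def by blast

lemma stably_proves_ImpI:
  assumes "insert \<phi> \<Gamma> \<tturnstile> \<psi>"
  shows "\<Gamma> \<tturnstile> \<phi> \<^bold>\<longrightarrow> \<psi>"
proof (rule stably_provesI)
  fix \<Gamma>' assume "finite \<Gamma>'" "\<Gamma> \<subseteq> \<Gamma>'"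
  then have "insert \<phi> \<Gamma>' \<turnstile> \<psi>" by (intro stably_provesD[OF assms]) auto
  then show "\<Gamma>' \<turnstile> \<phi> \<^bold>\<longrightarrow> \<psi>" by (rule ImpI)
qed

lemma stably_proves_cut:
  assumes "\<Gamma> \<tturnstile> \<phi>" "insert \<phi> \<Gamma> \<tturnstile> \<psi>"
  shows "\<Gamma> \<tturnstile> \<psi>"
  using assms(1) stably_proves_ImpI[OF assms(2)]
  unfolding stably_proves_def by (blast intro: ImpE)

lemma not_ExI_Neg_stably_proves: "{\<^bold>\<not> (\<^bold>\<exists>\<^sub>i x. \<^bold>\<not> \<phi>)} \<tturnstile> \<^bold>\<forall>\<^sub>i x. \<phi>"
proof (rule stably_provesI)
  fix \<Gamma> assume fin: "finite \<Gamma>" and sub: "{\<^bold>\<not> (\<^bold>\<exists>\<^sub>i x. \<^bold>\<not> \<phi>)} \<subseteq> \<Gamma>"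
  \<comment> \<open>The eigenvariable is chosen after the superset \<Gamma>, which may mention any
    variable fixed beforehand. No offset is wanted here, hence \<open>k = 0\<close>.\<close>
  obtain y where y: "isubst_ok x (y + 0) \<phi>" "y + 0 \<notin> ifree \<phi>" "\<forall>\<gamma>\<in>\<Gamma>. y + 0 \<notin> ifree \<gamma>"
    using exists_fresh_ivar[OF fin] by blast
  let ?\<Gamma> = "insert (\<^bold>\<not> isub x y \<phi>) \<Gamma>"
  have "?\<Gamma> \<turnstile> \<^bold>\<exists>\<^sub>i x. \<^bold>\<not> \<phi>" by (rule ExI_I[of _ _ y]) (use y in \<open>auto intro: Assm\<close>)
  moreover have "?\<Gamma> \<turnstile> \<^bold>\<not> (\<^bold>\<exists>\<^sub>i x. \<^bold>\<not> \<phi>)" using sub by (auto intro: Assm)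
  ultimately have "?\<Gamma> \<turnstile> \<^bold>\<bottom>" by (blast intro: ImpE)
  then have "\<Gamma> \<turnstile> isub x y \<phi>" by (rule Class)
  then show "\<Gamma> \<turnstile> \<^bold>\<forall>\<^sub>i x. \<phi>" by (rule AllI_I) (use y in auto)
qed

lemma not_ExP_Neg_stably_proves: "{\<^bold>\<not> (\<^bold>\<exists>\<^sub>p u. \<^bold>\<not> \<phi>)} \<tturnstile> \<^bold>\<forall>\<^sub>p u. \<phi>"
proof (rule stably_provesI)
  fix \<Gamma> assume fin: "finite \<Gamma>" and sub: "{\<^bold>\<not> (\<^bold>\<exists>\<^sub>p u. \<^bold>\<not> \<phi>)} \<subseteq> \<Gamma>"
  obtain v where v: "psubst_ok u (PVar (v + 0)) \<phi>" "v + 0 \<notin> pfree \<phi>" "\<forall>\<gamma>\<in>\<Gamma>. v + 0 \<notin> pfree \<gamma>"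
    using exists_fresh_pvar[OF fin] by blast
  let ?\<Gamma> = "insert (\<^bold>\<not> psub u (PVar v) \<phi>) \<Gamma>"
  have "?\<Gamma> \<turnstile> \<^bold>\<exists>\<^sub>p u. \<^bold>\<not> \<phi>" by (rule ExP_I[of _ _ "PVar v"]) (use v in \<open>auto intro: Assm\<close>)
  moreover have "?\<Gamma> \<turnstile> \<^bold>\<not> (\<^bold>\<exists>\<^sub>p u. \<^bold>\<not> \<phi>)" using sub by (auto intro: Assm)
  ultimately have "?\<Gamma> \<turnstile> \<^bold>\<bottom>" by (blast intro: ImpE)
  then have "\<Gamma> \<turnstile> psub u (PVar v) \<phi>" by (rule Class)
  then show "\<Gamma> \<turnstile> \<^bold>\<forall>\<^sub>p u. \<phi>" by (rule AllP_I) (use v in auto)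
qed

text \<open>If every instance were inconsistent with \<Gamma>, then for each finite superset the
  instance at a variable fresh for it would be, and \<open>ExI_E\<close> would refute that superset.
  As the fresh variable depends on the superset, all instances have to be considered
  together.\<close>

lemma consistent_ivar_witness:
  assumes "\<not> \<Gamma> \<tturnstile> \<^bold>\<bottom>" "(\<^bold>\<exists>\<^sub>i x. \<psi>) \<in> \<Gamma>"
  shows "\<exists>y. \<not> insert (isub x (y + k) \<psi>) \<Gamma> \<tturnstile> \<^bold>\<bottom>"
proof (rule ccontr)
  assume "\<not> ?thesis"
  then have incons: "insert (isub x (y + k) \<psi>) \<Gamma> \<tturnstile> \<^bold>\<bottom>" for y by blast
  have "\<Gamma> \<tturnstile> \<^bold>\<bottom>"
  proof (rule stably_provesI)
    fix \<Gamma>' assume fin: "finite \<Gamma>'" and sub: "\<Gamma> \<subseteq> \<Gamma>'"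
    obtain y where y: "isubst_ok x (y + k) \<psi>" "y + k \<notin> ifree \<psi>" "\<forall>\<gamma>\<in>\<Gamma>'. y + k \<notin> ifree \<gamma>"
      using exists_fresh_ivar[OF fin] by blast
    have "insert (isub x (y + k) \<psi>) \<Gamma>' \<turnstile> \<^bold>\<bottom>"
      using fin sub by (intro stably_provesD[OF incons[of y]]) auto
    moreover have "\<Gamma>' \<turnstile> \<^bold>\<exists>\<^sub>i x. \<psi>" using assms(2) sub by (auto intro: Assm)
    ultimately show "\<Gamma>' \<turnstile> \<^bold>\<bottom>" using y ExI_E[of \<Gamma>' x \<psi> "y + k"] by simp
  qed
  with assms(1) show False by blast
qed

lemma consistent_pvar_witness:
  assumes "\<not> \<Gamma> \<tturnstile> \<^bold>\<bottom>" "(\<^bold>\<exists>\<^sub>p u. \<psi>) \<in> \<Gamma>"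
  shows "\<exists>v. \<not> insert (psub u (PVar (v + k)) \<psi>) \<Gamma> \<tturnstile> \<^bold>\<bottom>"
proof (rule ccontr)
  assume "\<not> ?thesis"
  then have incons: "insert (psub u (PVar (v + k)) \<psi>) \<Gamma> \<tturnstile> \<^bold>\<bottom>" for v by blast
  have "\<Gamma> \<tturnstile> \<^bold>\<bottom>"
  proof (rule stably_provesI)
    fix \<Gamma>' assume fin: "finite \<Gamma>'" and sub: "\<Gamma> \<subseteq> \<Gamma>'"
    obtain v where v: "psubst_ok u (PVar (v + k)) \<psi>" "v + k \<notin> pfree \<psi>"
        "\<forall>\<gamma>\<in>\<Gamma>'. v + k \<notin> pfree \<gamma>"
      using exists_fresh_pvar[OF fin] by blast
    have "insert (psub u (PVar (v + k)) \<psi>) \<Gamma>' \<turnstile> \<^bold>\<bottom>"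
      using fin sub by (intro stably_provesD[OF incons[of v]]) auto
    moreover have "\<Gamma>' \<turnstile> \<^bold>\<exists>\<^sub>p u. \<psi>" using assms(2) sub by (auto intro: Assm)
    ultimately show "\<Gamma>' \<turnstile> \<^bold>\<bottom>" using v ExP_E[of \<Gamma>' u \<psi> "v + k"] by simp
  qed
  with assms(1) show False by blast
qed

text \<open>The Henkin property for the single formula \<chi>, vacuous unless \<chi> is existential.
  The offset keeps witnesses apart from the variables below \<open>k\<close>.\<close>

definition witnessed :: "nat \<Rightarrow> fm \<Rightarrow> fm set \<Rightarrow> bool" where
  "witnessed k \<chi> \<Delta> \<longleftrightarrow>
     (\<forall>x \<psi>. \<chi> = (\<^bold>\<exists>\<^sub>i x. \<psi>) \<longrightarrow> (\<exists>y. isub x (y + k) \<psi> \<in> \<Delta>)) \<and>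
     (\<forall>u \<psi>. \<chi> = (\<^bold>\<exists>\<^sub>p u. \<psi>) \<longrightarrow> (\<exists>v. psub u (PVar (v + k)) \<psi> \<in> \<Delta>))"

lemma witnessed_mono: "witnessed k \<chi> \<Gamma> \<Longrightarrow> \<Gamma> \<subseteq> \<Delta> \<Longrightarrow> witnessed k \<chi> \<Delta>"
  unfolding witnessed_def by blast

text \<open>One step of the Lindenbaum-Henkin construction. A refuted \<chi> is merely skipped; its
  negation is recovered later by closure under derivability.\<close>

lemma consistent_extension_step:
  assumes "finite \<Gamma>" "\<not> \<Gamma> \<tturnstile> \<^bold>\<bottom>"
  shows "\<exists>\<Gamma>'. (finite \<Gamma>' \<and> \<not> \<Gamma>' \<tturnstile> \<^bold>\<bottom>) \<and> \<Gamma> \<subseteq> \<Gamma>' \<and>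
           (insert \<chi> \<Gamma> \<tturnstile> \<^bold>\<bottom> \<or> \<chi> \<in> \<Gamma>' \<and> witnessed k \<chi> \<Gamma>')"
proof (cases "insert \<chi> \<Gamma> \<tturnstile> \<^bold>\<bottom>")
  case True
  with assms show ?thesis by blast
next
  case False
  let ?P = "\<lambda>\<Gamma>'. finite \<Gamma>' \<and> \<not> \<Gamma>' \<tturnstile> \<^bold>\<bottom> \<and> insert \<chi> \<Gamma> \<subseteq> \<Gamma>' \<and> witnessed k \<chi> \<Gamma>'"
  consider (i) x \<psi> where "\<chi> = (\<^bold>\<exists>\<^sub>i x. \<psi>)" | (p) u \<psi> where "\<chi> = (\<^bold>\<exists>\<^sub>p u. \<psi>)"
    | (other) "\<forall>x \<psi>. \<chi> \<noteq> (\<^bold>\<exists>\<^sub>i x. \<psi>)" "\<forall>u \<psi>. \<chi> \<noteq> (\<^bold>\<exists>\<^sub>p u. \<psi>)"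
    by blast
  then have "\<exists>\<Gamma>'. ?P \<Gamma>'"
  proof cases
    case i
    then obtain y where "\<not> insert (isub x (y + k) \<psi>) (insert \<chi> \<Gamma>) \<tturnstile> \<^bold>\<bottom>"
      using consistent_ivar_witness[OF False] by blast
    then have "?P (insert (isub x (y + k) \<psi>) (insert \<chi> \<Gamma>))"
      using i assms(1) by (auto simp: witnessed_def)
    then show ?thesis by blast
  next
    case p
    then obtain v where "\<not> insert (psub u (PVar (v + k)) \<psi>) (insert \<chi> \<Gamma>) \<tturnstile> \<^bold>\<bottom>"
      using consistent_pvar_witness[OF False] by blast
    then have "?P (insert (psub u (PVar (v + k)) \<psi>) (insert \<chi> \<Gamma>))"
      using p assms(1) by (auto simp: witnessed_def)
    then show ?thesis by blast
  next
    case other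
    then have "?P (insert \<chi> \<Gamma>)" using False assms(1) by (auto simp: witnessed_def)
    then show ?thesis by blast
  qed
  then show ?thesis by blast
qed

instance pterm :: countable by countable_datatype
instance fm :: countable by countable_datatype

text \<open>Closure is stated for finite \<Gamma> because an infinite set has no finite superset and
  so satisfies \<open>\<tturnstile>\<close> vacuously for every formula.\<close>

locale saturated =
  fixes k :: nat and \<Delta> :: "fm set"
  assumes closed: "\<And>\<Gamma> \<phi>. finite \<Gamma> \<Longrightarrow> \<Gamma> \<subseteq> \<Delta> \<Longrightarrow> \<Gamma> \<tturnstile> \<phi> \<Longrightarrow> \<phi> \<in> \<Delta>"
    and Bot_notin [simp]: "\<^bold>\<bottom> \<notin> \<Delta>"
    and complete: "\<And>\<phi>. \<phi> \<in> \<Delta> \<or> \<^bold>\<not> \<phi> \<in> \<Delta>"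
    and witness: "\<And>\<phi>. \<phi> \<in> \<Delta> \<Longrightarrow> witnessed k \<phi> \<Delta>"

lemma saturated_extension:
  assumes "finite \<Gamma>" "\<not> \<Gamma> \<tturnstile> \<^bold>\<bottom>"
  shows "\<exists>\<Delta>. \<Gamma> \<subseteq> \<Delta> \<and> saturated k \<Delta>"
proof -
  \<comment> \<open>Stage \<open>n\<close> treats the formula with code \<open>n\<close>; the clause
    for \<open>n = 0\<close> ties the start of the chain to \<Gamma>.\<close>
  have "\<exists>G. \<forall>n. (finite (G n) \<and> \<not> G n \<tturnstile> \<^bold>\<bottom> \<and> (n = 0 \<longrightarrow> G n = \<Gamma>)) \<and> G n \<subseteq> G (Suc n) \<and>
      (insert (from_nat n) (G n) \<tturnstile> \<^bold>\<bottom> \<or>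
        from_nat n \<in> G (Suc n) \<and> witnessed k (from_nat n) (G (Suc n)))"
  proof (rule dependent_nat_choice)
    show "\<exists>\<Gamma>'. finite \<Gamma>' \<and> \<not> \<Gamma>' \<tturnstile> \<^bold>\<bottom> \<and> ((0::nat) = 0 \<longrightarrow> \<Gamma>' = \<Gamma>)" using assms by blast
  next
    fix \<Gamma>' and n :: nat
    assume "finite \<Gamma>' \<and> \<not> \<Gamma>' \<tturnstile> \<^bold>\<bottom> \<and> (n = 0 \<longrightarrow> \<Gamma>' = \<Gamma>)"
    then show "\<exists>\<Gamma>''. (finite \<Gamma>'' \<and> \<not> \<Gamma>'' \<tturnstile> \<^bold>\<bottom> \<and> (Suc n = 0 \<longrightarrow> \<Gamma>'' = \<Gamma>)) \<and> \<Gamma>' \<subseteq> \<Gamma>'' \<and>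
        (insert (from_nat n) \<Gamma>' \<tturnstile> \<^bold>\<bottom> \<or> from_nat n \<in> \<Gamma>'' \<and> witnessed k (from_nat n) \<Gamma>'')"
      using consistent_extension_step[of \<Gamma>' "from_nat n" k] by simp
  qed
  then obtain G where G0: "G 0 = \<Gamma>" and fin: "\<And>n. finite (G n)"
      and con: "\<And>n. \<not> G n \<tturnstile> \<^bold>\<bottom>" and Suc: "\<And>n. G n \<subseteq> G (Suc n)"
      and step: "\<And>n. insert (from_nat n) (G n) \<tturnstile> \<^bold>\<bottom> \<or>
        from_nat n \<in> G (Suc n) \<and> witnessed k (from_nat n) (G (Suc n))"
    by metis
  define \<Delta> where "\<Delta> = (\<Union>n. G n)"
  have mono: "m \<le> n \<Longrightarrow> G m \<subseteq> G n" for m n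
    using Suc by (rule lift_Suc_mono_le)
  have decide: "\<exists>n. insert \<phi> (G n) \<tturnstile> \<^bold>\<bottom> \<or> \<phi> \<in> G (Suc n) \<and> witnessed k \<phi> (G (Suc n))" for \<phi>
    using step[of "to_nat \<phi>"] by auto
  have finite_sub: "\<exists>n. X \<subseteq> G n" if "finite X" "X \<subseteq> \<Delta>" for X
    using that
  proof (induction X rule: finite_induct)
    case (insert \<phi> X)
    then obtain m n where "X \<subseteq> G m" "\<phi> \<in> G n" by (auto simp: \<Delta>_def)
    then have "insert \<phi> X \<subseteq> G (max m n)"
      using mono[of m "max m n"] mono[of n "max m n"] by auto
    then show ?case by blast
  qed auto
  \<comment> \<open>A formula derivable from a finite part of \<Delta> was never refuted: at a stage
    late enough for both the derivation and the refutation, a cut would yield a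
    contradiction.\<close>
  have no_conflict: False if "\<Gamma>' \<tturnstile> \<phi>" "finite \<Gamma>'" "\<Gamma>' \<subseteq> \<Delta>" "insert \<phi> (G n) \<tturnstile> \<^bold>\<bottom>" for \<Gamma>' \<phi> n
  proof -
    from finite_sub that(2,3) obtain m where m: "\<Gamma>' \<subseteq> G m" by blast
    have "G (max m n) \<tturnstile> \<phi>"
      using that(1) by (rule stably_proves_mono) (use m mono[of m "max m n"] in auto)
    moreover have "insert \<phi> (G (max m n)) \<tturnstile> \<^bold>\<bottom>"
      using that(4) by (rule stably_proves_mono) (use mono[of n "max m n"] in auto)
    ultimately show False using con stably_proves_cut by blast
  qed
  have refl: "{\<phi>} \<tturnstile> \<phi>" for \<phi> by (rule stably_provesI) (auto intro: Assm)
  have cl: "\<phi> \<in> \<Delta>" if "finite \<Gamma>'" "\<Gamma>' \<subseteq> \<Delta>" "\<Gamma>' \<tturnstile> \<phi>" for \<Gamma>' \<phi>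
    using decide[of \<phi>] no_conflict[OF that(3,1,2)] unfolding \<Delta>_def by blast
  have "saturated k \<Delta>"
  proof
    show "\<phi> \<in> \<Delta>" if "finite \<Gamma>'" "\<Gamma>' \<subseteq> \<Delta>" "\<Gamma>' \<tturnstile> \<phi>" for \<Gamma>' \<phi> using that by (rule cl)
    show "\<^bold>\<bottom> \<notin> \<Delta>"
    proof
      assume "\<^bold>\<bottom> \<in> \<Delta>"
      then obtain n where "\<^bold>\<bottom> \<in> G n" by (auto simp: \<Delta>_def)
      then show False using con[of n] stably_proves_mono[OF refl] by blast
    qed
    \<comment> \<open>If \<phi> was refuted at stage \<open>n\<close>, then \<open>G n\<close>
      derives its negation, which therefore belongs to \<Delta>.\<close>
    show "\<phi> \<in> \<Delta> \<or> \<^bold>\<not> \<phi> \<in> \<Delta>" for \<phi>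
    proof -
      obtain n where "insert \<phi> (G n) \<tturnstile> \<^bold>\<bottom> \<or> \<phi> \<in> G (Suc n)" using decide[of \<phi>] by blast
      then show ?thesis
        using cl[OF fin, of n] stably_proves_ImpI[of \<phi> "G n" "\<^bold>\<bottom>"] unfolding \<Delta>_def by blast
    qed
    show "witnessed k \<phi> \<Delta>" if "\<phi> \<in> \<Delta>" for \<phi>
    proof -
      obtain n where "insert \<phi> (G n) \<tturnstile> \<^bold>\<bottom> \<or> witnessed k \<phi> (G (Suc n))" using decide[of \<phi>] by blast
      then show ?thesis
        using no_conflict[OF refl, of \<phi> n] that witnessed_mono[of k \<phi> "G (Suc n)" \<Delta>]
        unfolding \<Delta>_def by blast
    qed
  qed
  moreover have "\<Gamma> \<subseteq> \<Delta>" using G0 by (auto simp: \<Delta>_def)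
  ultimately show ?thesis by blast
qed

text \<open>If \<phi> is underivable, \<open>Class\<close> makes \<Gamma> consistent with the
  negation of \<phi>; here finiteness matters, since the set itself is then among the supersets over
  which \<open>\<tturnstile>\<close> ranges. A saturated extension would contain \<phi> and its
  negation.\<close>

theorem saturated_completeness:
  assumes "finite \<Gamma>" "\<And>\<Delta>. saturated k \<Delta> \<Longrightarrow> \<Gamma> \<subseteq> \<Delta> \<Longrightarrow> \<phi> \<in> \<Delta>"
  shows "\<Gamma> \<turnstile> \<phi>"
proof (rule ccontr)
  assume "\<not> \<Gamma> \<turnstile> \<phi>"
  then have "\<not> insert (\<^bold>\<not> \<phi>) \<Gamma> \<tturnstile> \<^bold>\<bottom>"
    using stably_provesD[of "insert (\<^bold>\<not> \<phi>) \<Gamma>"] assms(1) Class by blast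
  then obtain \<Delta> where \<Delta>: "insert (\<^bold>\<not> \<phi>) \<Gamma> \<subseteq> \<Delta>" "saturated k \<Delta>"
    using saturated_extension assms(1) by (meson finite.insertI)
  interpret saturated k \<Delta> by (rule \<Delta>(2))
  have "{\<phi>, \<^bold>\<not> \<phi>} \<tturnstile> \<^bold>\<bottom>"
    by (rule stably_provesI, rule ImpE[of _ \<phi>]) (auto intro: Assm)
  moreover have "{\<phi>, \<^bold>\<not> \<phi>} \<subseteq> \<Delta>" using assms(2)[OF \<Delta>(2)] \<Delta>(1) by blast
  ultimately have "\<^bold>\<bottom> \<in> \<Delta>" by (intro closed) simp_all
  then show False by simp
qed


section \<open>Truth in a saturated set\<close>

text \<open>
  Shifting the variables of the instances away from the finitely many variables that occur in
  the axioms makes all substitutions capture-free.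
\<close>

primrec shift_t :: "nat \<Rightarrow> pterm \<Rightarrow> pterm" where
  "shift_t k (PVar v) = PVar (v + k)"
| "shift_t k AA = AA"
| "shift_t k (AtP t) = AtP (shift_t k t)"
| "shift_t k (AtI x) = AtI (x + k)"

lemma notin_ivars_shift_t [simp]: "x < k \<Longrightarrow> x \<notin> ivars_t (shift_t k t)"
  by (induction t) auto

lemma notin_pvars_shift_t [simp]: "v < k \<Longrightarrow> v \<notin> pvars_t (shift_t k t)"
  by (induction t) auto

lemma isub_t_shift_t [simp]: "x < k \<Longrightarrow> isub_t x y (shift_t k t) = shift_t k t"
  by (induction t) (auto simp: isub_v_def)

lemma psub_t_shift_t [simp]: "u < k \<Longrightarrow> psub_t u s (shift_t k t) = shift_t k t"
  by (induction t) auto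

context saturated
begin

lemma derivedI:
  assumes "\<phi> \<in> \<Delta>" "\<And>\<Gamma>. finite \<Gamma> \<Longrightarrow> \<Gamma> \<turnstile> \<phi> \<Longrightarrow> \<Gamma> \<turnstile> \<psi>"
  shows "\<psi> \<in> \<Delta>"
  by (rule closed[of "{\<phi>}"]) (use assms in \<open>auto intro!: stably_provesI intro: Assm\<close>)

lemma derived2I:
  assumes "\<phi> \<in> \<Delta>" "\<chi> \<in> \<Delta>" "\<And>\<Gamma>. finite \<Gamma> \<Longrightarrow> \<Gamma> \<turnstile> \<phi> \<Longrightarrow> \<Gamma> \<turnstile> \<chi> \<Longrightarrow> \<Gamma> \<turnstile> \<psi>"
  shows "\<psi> \<in> \<Delta>"
  by (rule closed[of "{\<phi>, \<chi>}"]) (use assms in \<open>auto intro!: stably_provesI intro: Assm\<close>)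

lemma mp: "\<phi> \<^bold>\<longrightarrow> \<psi> \<in> \<Delta> \<Longrightarrow> \<phi> \<in> \<Delta> \<Longrightarrow> \<psi> \<in> \<Delta>"
  by (erule (1) derived2I) (rule ImpE)

text \<open>Negation is implication of falsity, so together with \<open>Bot_notin\<close> this also
  evaluates negated formulas.\<close>

lemma Imp_iff [simp]: "\<phi> \<^bold>\<longrightarrow> \<psi> \<in> \<Delta> \<longleftrightarrow> (\<phi> \<in> \<Delta> \<longrightarrow> \<psi> \<in> \<Delta>)"
proof
  assume r: "\<phi> \<in> \<Delta> \<longrightarrow> \<psi> \<in> \<Delta>"
  show "\<phi> \<^bold>\<longrightarrow> \<psi> \<in> \<Delta>"
  proof (cases "\<phi> \<in> \<Delta>")
    case True
    with r have "\<psi> \<in> \<Delta>" by simp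
    moreover have "{\<psi>} \<tturnstile> \<phi> \<^bold>\<longrightarrow> \<psi>" by (auto intro!: stably_provesI ImpI intro: Assm)
    ultimately show ?thesis using closed[of "{\<psi>}"] by simp
  next
    case False
    then have "\<^bold>\<not> \<phi> \<in> \<Delta>" using complete by blast
    moreover have "{\<^bold>\<not> \<phi>} \<tturnstile> \<phi> \<^bold>\<longrightarrow> \<psi>"
      by (rule stably_provesI, rule ImpI, rule Class, rule ImpE[of _ \<phi>]) (auto intro: Assm)
    ultimately show ?thesis using closed[of "{\<^bold>\<not> \<phi>}"] by simp
  qed
qed (use mp in blast)

lemma And_iff [simp]: "\<phi> \<^bold>\<and> \<psi> \<in> \<Delta> \<longleftrightarrow> \<phi> \<in> \<Delta> \<and> \<psi> \<in> \<Delta>"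
  by (meson derivedI derived2I AndI AndE1 AndE2)

lemma ExI_iff:
  assumes "\<And>y. isubst_ok x (y + k) \<phi>"
  shows "(\<^bold>\<exists>\<^sub>i x. \<phi>) \<in> \<Delta> \<longleftrightarrow> (\<exists>y. isub x (y + k) \<phi> \<in> \<Delta>)"
proof
  show "(\<^bold>\<exists>\<^sub>i x. \<phi>) \<in> \<Delta> \<Longrightarrow> \<exists>y. isub x (y + k) \<phi> \<in> \<Delta>"
    using witness unfolding witnessed_def by blast
  show "\<exists>y. isub x (y + k) \<phi> \<in> \<Delta> \<Longrightarrow> (\<^bold>\<exists>\<^sub>i x. \<phi>) \<in> \<Delta>"
    using assms by (blast intro: derivedI ExI_I)
qed

text \<open>The plural domain consists of all terms. A witness is a variable, which is a shifted
  term, and conversely \<open>ExP_I\<close> accepts any term. Thus \<open>AA\<close>,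
  \<open>AtI x\<close> and \<open>AtP t\<close> are available as plural objects.\<close>

lemma ExP_iff:
  assumes "\<And>t. psubst_ok u (shift_t k t) \<phi>"
  shows "(\<^bold>\<exists>\<^sub>p u. \<phi>) \<in> \<Delta> \<longleftrightarrow> (\<exists>t. psub u (shift_t k t) \<phi> \<in> \<Delta>)"
proof
  assume "(\<^bold>\<exists>\<^sub>p u. \<phi>) \<in> \<Delta>"
  then obtain v where "psub u (shift_t k (PVar v)) \<phi> \<in> \<Delta>"
    using witness unfolding witnessed_def by fastforce
  then show "\<exists>t. psub u (shift_t k t) \<phi> \<in> \<Delta>" by blast
next
  show "\<exists>t. psub u (shift_t k t) \<phi> \<in> \<Delta> \<Longrightarrow> (\<^bold>\<exists>\<^sub>p u. \<phi>) \<in> \<Delta>"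
    using assms by (blast intro: derivedI ExP_I)
qed

text \<open>If all instances hold, no counterexample can be witnessed, so \<Delta> denies that one
  exists and \<open>not_ExI_Neg_stably_proves\<close> applies.\<close>

lemma AllI_iff:
  assumes ok: "\<And>y. isubst_ok x (y + k) \<phi>"
  shows "(\<^bold>\<forall>\<^sub>i x. \<phi>) \<in> \<Delta> \<longleftrightarrow> (\<forall>y. isub x (y + k) \<phi> \<in> \<Delta>)"
proof
  show "(\<^bold>\<forall>\<^sub>i x. \<phi>) \<in> \<Delta> \<Longrightarrow> \<forall>y. isub x (y + k) \<phi> \<in> \<Delta>"
    using ok by (blast intro: derivedI AllI_E)
  assume "\<forall>y. isub x (y + k) \<phi> \<in> \<Delta>"
  then have "\<^bold>\<not> (\<^bold>\<exists>\<^sub>i x. \<^bold>\<not> \<phi>) \<in> \<Delta>" using ok by (simp add: ExI_iff)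
  then show "(\<^bold>\<forall>\<^sub>i x. \<phi>) \<in> \<Delta>" using closed[OF _ _ not_ExI_Neg_stably_proves] by blast
qed

lemma AllP_iff:
  assumes ok: "\<And>t. psubst_ok u (shift_t k t) \<phi>"
  shows "(\<^bold>\<forall>\<^sub>p u. \<phi>) \<in> \<Delta> \<longleftrightarrow> (\<forall>t. psub u (shift_t k t) \<phi> \<in> \<Delta>)"
proof
  show "(\<^bold>\<forall>\<^sub>p u. \<phi>) \<in> \<Delta> \<Longrightarrow> \<forall>t. psub u (shift_t k t) \<phi> \<in> \<Delta>"
    using ok by (blast intro: derivedI AllP_E)
  assume "\<forall>t. psub u (shift_t k t) \<phi> \<in> \<Delta>"
  then have "\<^bold>\<not> (\<^bold>\<exists>\<^sub>p u. \<^bold>\<not> \<phi>) \<in> \<Delta>" using ok by (simp add: ExP_iff)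
  then show "(\<^bold>\<forall>\<^sub>p u. \<phi>) \<in> \<Delta>" using closed[OF _ _ not_ExP_Neg_stably_proves] by blast
qed

lemma Eq_refl: "x \<^bold>= x \<in> \<Delta>"
  by (rule closed[of "{}"]) (auto intro: stably_provesI EqRefl)

lemma Eq_subst:
  assumes "x \<^bold>= y \<in> \<Delta>" "isub z x \<phi> \<in> \<Delta>" "isubst_ok z x \<phi>" "isubst_ok z y \<phi>"
  shows "isub z y \<phi> \<in> \<Delta>"
  by (rule derived2I[OF assms(1,2)]) (use assms(3,4) in \<open>auto intro: EqSubst\<close>)

end


section \<open>Atomistic mereology\<close>

text \<open>\<open>E\<close> stands for identity: distinct variables may be equated by \<Delta>, so
  HOL equality would be too fine. Likewise coextensive elements of the plural domain stay
  distinct.\<close>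

locale atomistic_mereology =
  fixes E :: "'i \<Rightarrow> 'i \<Rightarrow> bool" and P :: "'i \<Rightarrow> 'i \<Rightarrow> bool" and A :: "'i \<Rightarrow> bool"
    and M :: "'i \<Rightarrow> 'p \<Rightarrow> bool" and F :: "'p \<Rightarrow> 'i \<Rightarrow> bool"
    and aa :: 'p and ati :: "'i \<Rightarrow> 'p" and atp :: "'p \<Rightarrow> 'p"
  assumes E_sym: "E x y \<Longrightarrow> E y x"
    and E_trans: "E x y \<Longrightarrow> E y z \<Longrightarrow> E x z"
    and E_mem: "E x y \<Longrightarrow> M x t \<Longrightarrow> M y t"
    and P_refl: "P x x"
    and P_trans: "P x y \<Longrightarrow> P y z \<Longrightarrow> P x z"
    and P_antisym: "P x y \<Longrightarrow> P y x \<Longrightarrow> E x y"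
    and P_suppl: "\<not> P x y \<Longrightarrow> \<exists>z. P z x \<and> \<not> (\<exists>w. P w z \<and> P w y)"
    and A_iff: "A x \<longleftrightarrow> (\<forall>y. P y x \<longrightarrow> E x y)"
    and F_iff: "F t x \<longleftrightarrow> (\<forall>z. M z t \<longrightarrow> P z x) \<and>
      (\<forall>y. P y x \<longrightarrow> (\<exists>z. M z t \<and> (\<exists>w. P w z \<and> P w y)))"
    and atomicity: "\<exists>y. P y x \<and> A y"
    and aa_iff: "M x aa \<longleftrightarrow> A x"
    and ati_iff: "M y (ati x) \<longleftrightarrow> P y x \<and> M y aa"
    and atp_iff: "M y (atp t) \<longleftrightarrow> (\<exists>z. M z t \<and> P y z \<and> M y aa)"
begin

text \<open>Otherwise supplementation gives a part of \<open>x\<close> disjoint from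
  \<open>y\<close>; an atom of that part lies in \<open>x\<close>, hence in \<open>y\<close>, a
  contradiction.\<close>

lemma part_iff_atoms: "P x y \<longleftrightarrow> (\<forall>a. A a \<longrightarrow> P a x \<longrightarrow> P a y)"
proof
  show "P x y \<Longrightarrow> \<forall>a. A a \<longrightarrow> P a x \<longrightarrow> P a y" using P_trans by blast
  assume atoms: "\<forall>a. A a \<longrightarrow> P a x \<longrightarrow> P a y"
  show "P x y"
  proof (rule ccontr)
    assume "\<not> P x y"
    then obtain z where z: "P z x" "\<not> (\<exists>w. P w z \<and> P w y)" using P_suppl by blast
    obtain a where a: "P a z" "A a" using atomicity by blast
    then have "P a y" using atoms P_trans z(1) by blast
    with a(1) z(2) show False by blast
  qed
qed

text \<open>An atom equals each of its parts, so both atoms equal \<open>w\<close>.\<close>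

lemma atom_part_atom: "A a \<Longrightarrow> A b \<Longrightarrow> P w a \<Longrightarrow> P w b \<Longrightarrow> E a b"
  using A_iff E_sym E_trans by blast

text \<open>Any part of \<open>x\<close> contains an atom, which is then an atom of \<open>x\<close>
  overlapping that part.\<close>

lemma fusion_ati: "F (ati x) x"
  unfolding F_iff ati_iff aa_iff by (metis P_refl P_trans atomicity)

lemma fusion_ati_unique: "F (ati x) y \<Longrightarrow> E x y"
proof (rule P_antisym)
  assume F: "F (ati x) y"
  show "P x y"
    unfolding part_iff_atoms[of x y] using F by (simp add: F_iff ati_iff aa_iff)
  show "P y x"
  proof (rule ccontr)
    assume "\<not> P y x"
    \<comment> \<open>The part \<open>z\<close> of the fusion \<open>y\<close> must overlap some
      atom of \<open>x\<close>, and the common part lies in \<open>x\<close>.\<close>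
    then obtain z where z: "P z y" "\<not> (\<exists>w. P w z \<and> P w x)" using P_suppl by blast
    then obtain a w where "M a (ati x)" "P w a" "P w z" using F by (auto simp: F_iff)
    with z show False using P_trans by (auto simp: ati_iff)
  qed
qed

text \<open>An atom equals whatever it is fused from, since that is part of it. Conversely, taking
  \<open>t\<close> to be \<open>ati x\<close> equates \<open>x\<close> with an atom below it, and
  \<open>E_mem\<close> transfers atomicity.\<close>

lemma aa_iff_fusion: "M x aa \<longleftrightarrow> (\<forall>t z. M z t \<longrightarrow> F t x \<longrightarrow> E z x)"
proof
  show "M x aa \<Longrightarrow> \<forall>t z. M z t \<longrightarrow> F t x \<longrightarrow> E z x"
    using A_iff E_sym F_iff aa_iff by blast
  show "\<forall>t z. M z t \<longrightarrow> F t x \<longrightarrow> E z x \<Longrightarrow> M x aa"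
    using fusion_ati atomicity[of x] E_mem aa_iff ati_iff by metis
qed

text \<open>The plural \<open>s\<close> composing \<open>z\<close> is \<open>ati z\<close>, nonempty
  because it contains \<open>x\<close>.\<close>

lemma atp_iff_fusion:
  "M x (atp t) \<longleftrightarrow>
     (\<exists>y. M y t \<and> (\<exists>s. ((\<forall>z. M z s \<longrightarrow> M z aa) \<and> (\<exists>z. M z s)) \<and> F s y \<and> M x s))"
  (is "?L \<longleftrightarrow> ?R")
proof
  assume ?L
  then obtain z where "M z t" "M x (ati z)" by (auto simp: atp_iff ati_iff)
  then show ?R using fusion_ati[of z] ati_iff by blast
next
  assume ?R
  then show ?L by (auto simp: atp_iff F_iff)
qed

text \<open>An atom of the fusion overlaps a member of \<open>s\<close>; both being atoms, they are
  equal. Conversely, \<open>F\<close> depends only on the members of its plural argument, so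
  \<open>fusion_ati\<close> carries over.\<close>

lemma fusion_atoms_iff:
  assumes s: "\<forall>z. M z s \<longrightarrow> M z aa"
  shows "F s x \<longleftrightarrow> (\<forall>z. M z s \<longleftrightarrow> M z (ati x))"
proof
  assume F: "F s x"
  show "\<forall>z. M z s \<longleftrightarrow> M z (ati x)"
  proof (intro allI iffI)
    fix z
    show "M z s \<Longrightarrow> M z (ati x)" using F s by (auto simp: F_iff ati_iff)
    assume z: "M z (ati x)"
    then obtain b w where b: "M b s" "P w b" "P w z" using F by (auto simp: F_iff ati_iff)
    then have "E b z" using z s atom_part_atom[of b z w] by (auto simp: ati_iff aa_iff)
    with b show "M z s" using E_mem by blast
  qed
next
  assume "\<forall>z. M z s \<longleftrightarrow> M z (ati x)"
  then show "F s x" using fusion_ati[of x] by (simp add: F_iff)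
qed

lemma fusion_atp_iff: "F t x \<longleftrightarrow> F (atp t) x"
proof
  assume F: "F t x"
  show "F (atp t) x"
    unfolding F_iff
  proof (intro conjI allI impI)
    show "P z x" if "M z (atp t)" for z using that F P_trans by (auto simp: F_iff atp_iff)
    fix y assume "P y x"
    then obtain z w where z: "M z t" "P w z" "P w y" using F by (auto simp: F_iff)
    \<comment> \<open>The overlap of \<open>y\<close> with a member of \<open>t\<close> need not be
      atomic; an atom inside it belongs to \<open>atp t\<close>.\<close>
    obtain a where "P a w" "A a" using atomicity by blast
    with z show "\<exists>z. M z (atp t) \<and> (\<exists>w. P w z \<and> P w y)"
      unfolding atp_iff aa_iff by (metis P_refl P_trans)
  qed
next
  assume F: "F (atp t) x"
  show "F t x"
    unfolding F_iff
  proof (intro conjI allI impI)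
    \<comment> \<open>All atoms of \<open>z\<close> belong to \<open>atp t\<close>, hence lie in
      \<open>x\<close>; parthood is inclusion of atoms.\<close>
    show "P z x" if "M z t" for z
      unfolding part_iff_atoms[of z x] using that F by (auto simp: F_iff atp_iff aa_iff)
    fix y assume "P y x"
    then show "\<exists>z. M z t \<and> (\<exists>w. P w z \<and> P w y)"
      using F P_trans unfolding F_iff atp_iff by meson
  qed
qed

lemma ati_nonempty: "\<exists>z. M z (ati x)"
  using atomicity by (simp add: ati_iff aa_iff)

text \<open>The nonemptiness conjunct is the second half of \<open>SubP\<close>, which the
  definition of parthood in ATC carries along.\<close>

lemma part_iff_ati:
  "P x y \<longleftrightarrow> (\<forall>z. M z (ati x) \<longrightarrow> M z (ati y)) \<and> (\<exists>z. M z (ati x))"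
  using ati_nonempty[of x] by (auto simp: part_iff_atoms[of x y] ati_iff aa_iff)

end


section \<open>The axioms of ATC\<close>

abbreviation (input) AEM_defs :: "fm set" where
  "AEM_defs \<equiv> AEM_pl \<union> {Df_aa_P, Df_at_ind_P, Df_at_pl_P}"

text \<open>Only the variables \<open>0, \<dots>, 3\<close> occur in the axioms, hence the shift by 4.\<close>

lemma saturated_atomistic_mereology:
  assumes "saturated 4 \<Delta>" and ax: "AEM_defs \<subseteq> \<Delta>"
  shows "atomistic_mereology (\<lambda>x y. (x + 4) \<^bold>= (y + 4) \<in> \<Delta>) (\<lambda>x y. Part (x + 4) (y + 4) \<in> \<Delta>)
    (\<lambda>x. Atom (x + 4) \<in> \<Delta>) (\<lambda>x t. (x + 4) \<^bold>\<prec> shift_t 4 t \<in> \<Delta>)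
    (\<lambda>t x. Fus (shift_t 4 t) (x + 4) \<in> \<Delta>) AA AtI AtP"
proof -
  interpret saturated 4 \<Delta> by fact
  note truth = ExI_iff AllI_iff ExP_iff AllP_iff isub_v_def Overlap_def Let_def
  let ?E = "\<lambda>x y. (x + 4) \<^bold>= (y + 4) \<in> \<Delta>" and ?P = "\<lambda>x y. Part (x + 4) (y + 4) \<in> \<Delta>"
    and ?A = "\<lambda>x. Atom (x + 4) \<in> \<Delta>" and ?M = "\<lambda>x t. (x + 4) \<^bold>\<prec> shift_t 4 t \<in> \<Delta>"
    and ?F = "\<lambda>t x. Fus (shift_t 4 t) (x + 4) \<in> \<Delta>"
  \<comment> \<open>In these three facts the variable \<open>0\<close> is the placeholder for
    substitution; it differs from all shifted variables.\<close>
  have E_sym: "?E y x" if "?E x y" for x y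
    using Eq_subst[OF that, of 0 "0 \<^bold>= (x + 4)"] Eq_refl by (simp add: isub_v_def)
  have E_trans: "?E x z" if "?E x y" "?E y z" for x y z
    using Eq_subst[OF that(2), of 0 "(x + 4) \<^bold>= 0"] that(1) by (simp add: isub_v_def)
  have E_mem: "?M y t" if "?E x y" "?M x t" for x y t
    using Eq_subst[OF that(1), of 0 "0 \<^bold>\<prec> shift_t 4 t"] that(2) by (simp add: isub_v_def)
  \<comment> \<open>Each axiom is now evaluated in \<Delta>. Object-level biconditionals are
    conjunctions of implications, whence \<open>iff_conv_conj_imp\<close>.\<close>
  have refl: "P_refl \<in> \<Delta> \<longleftrightarrow> (\<forall>x. ?P x x)"
    by (simp add: P_refl_def truth)
  have trans: "P_trans \<in> \<Delta> \<longleftrightarrow> (\<forall>x y z. ?P x y \<and> ?P y z \<longrightarrow> ?P x z)"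
    by (simp add: P_trans_def truth)
  have antisym: "P_antisym \<in> \<Delta> \<longleftrightarrow> (\<forall>x y. ?P x y \<and> ?P y x \<longrightarrow> ?E x y)"
    by (simp add: P_antisym_def truth)
  have suppl: "P_supplementation \<in> \<Delta> \<longleftrightarrow>
      (\<forall>x y. \<not> ?P x y \<longrightarrow> (\<exists>z. ?P z x \<and> \<not> (\<exists>w. ?P w z \<and> ?P w y)))"
    by (simp add: P_supplementation_def truth)
  have A: "Df_A \<in> \<Delta> \<longleftrightarrow> (\<forall>x. ?A x \<longleftrightarrow> (\<forall>y. ?P y x \<longrightarrow> ?E x y))"
    by (simp add: Df_A_def truth iff_conv_conj_imp)
  have F: "Df_F \<in> \<Delta> \<longleftrightarrow> (\<forall>t x. ?F t x \<longleftrightarrow> (\<forall>z. ?M z t \<longrightarrow> ?P z x) \<and>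
      (\<forall>y. ?P y x \<longrightarrow> (\<exists>z. ?M z t \<and> (\<exists>w. ?P w z \<and> ?P w y))))"
    by (simp add: Df_F_def truth iff_conv_conj_imp)
  have atomicity: "P_atomicity \<in> \<Delta> \<longleftrightarrow> (\<forall>x. \<exists>y. ?P y x \<and> ?A y)"
    by (simp add: P_atomicity_def truth)
  have aa: "Df_aa_P \<in> \<Delta> \<longleftrightarrow> (\<forall>x. ?M x AA \<longleftrightarrow> ?A x)"
    by (simp add: Df_aa_P_def truth iff_conv_conj_imp)
  have ati: "Df_at_ind_P \<in> \<Delta> \<longleftrightarrow> (\<forall>x y. ?M y (AtI x) \<longleftrightarrow> ?P y x \<and> ?M y AA)"
    by (simp add: Df_at_ind_P_def truth iff_conv_conj_imp)
  have atp: "Df_at_pl_P \<in> \<Delta> \<longleftrightarrow>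
      (\<forall>t y. ?M y (AtP t) \<longleftrightarrow> (\<exists>z. ?M z t \<and> ?P y z \<and> ?M y AA))"
    by (simp add: Df_at_pl_P_def truth iff_conv_conj_imp)
  have "P_refl \<in> \<Delta>" "P_trans \<in> \<Delta>" "P_antisym \<in> \<Delta>" "P_supplementation \<in> \<Delta>" "Df_A \<in> \<Delta>" "Df_F \<in> \<Delta>"
    "P_atomicity \<in> \<Delta>" "Df_aa_P \<in> \<Delta>" "Df_at_ind_P \<in> \<Delta>" "Df_at_pl_P \<in> \<Delta>"
    using ax by (simp_all add: AEM_pl_def)
  note axs = this[unfolded refl trans antisym suppl A F atomicity aa ati atp]
  show ?thesis
    by unfold_locales (fact E_sym, fact E_trans, fact E_mem, use axs(1) in blast, use axs(2) in blast,
        use axs(3) in blast, use axs(4) in blast, use axs(5) in blast, use axs(6) in blast,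
        use axs(7) in blast, use axs(8) in blast, use axs(9) in blast, use axs(10) in blast)
qed

lemma saturated_ATC:
  assumes "saturated 4 \<Delta>" and "AEM_defs \<subseteq> \<Delta>"
  shows "ATC \<union> {Df_P_F, Df_A_F} \<subseteq> \<Delta>"
proof -
  interpret saturated 4 \<Delta> by fact
  interpret S: atomistic_mereology "\<lambda>x y. (x + 4) \<^bold>= (y + 4) \<in> \<Delta>" "\<lambda>x y. Part (x + 4) (y + 4) \<in> \<Delta>"
    "\<lambda>x. Atom (x + 4) \<in> \<Delta>" "\<lambda>x t. (x + 4) \<^bold>\<prec> shift_t 4 t \<in> \<Delta>"
    "\<lambda>t x. Fus (shift_t 4 t) (x + 4) \<in> \<Delta>" AA AtI AtP
    by (rule saturated_atomistic_mereology) fact+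
  let ?E = "\<lambda>x y. (x + 4) \<^bold>= (y + 4) \<in> \<Delta>" and ?M = "\<lambda>x t. (x + 4) \<^bold>\<prec> shift_t 4 t \<in> \<Delta>"
    and ?F = "\<lambda>t x. Fus (shift_t 4 t) (x + 4) \<in> \<Delta>"
  let ?sub_aa = "\<lambda>t. (\<forall>z. ?M z t \<longrightarrow> ?M z AA) \<and> (\<exists>z. ?M z t)"
  note truth = ExI_iff AllI_iff ExP_iff AllP_iff isub_v_def SubP_def Coext_def Let_def
  have "Ax_aa_F \<in> \<Delta>"
    using S.aa_iff_fusion by (simp add: Ax_aa_F_def truth)
  moreover have "Ax_at_F \<in> \<Delta>"
    using S.atp_iff_fusion by (simp add: Ax_at_F_def truth)
  moreover have "ATC2 \<in> \<Delta>"
    using S.fusion_atp_iff by (simp add: ATC2_def truth)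
  moreover have "Df_P_F \<in> \<Delta>"
    using S.part_iff_ati by (simp add: Df_P_F_def truth)
  moreover have "Df_A_F \<in> \<Delta>"
    using S.aa_iff by (simp add: Df_A_F_def truth)
  moreover
  have sub: "?sub_aa (AtI x)" for x
    using S.ati_nonempty S.ati_iff by blast
  have fus: "?F t x \<longleftrightarrow> (\<forall>z. ?M z t \<longleftrightarrow> ?M z (AtI x))" if "?sub_aa t" for t x
    using that by (intro S.fusion_atoms_iff) blast
  have "Ax_at_ind_F \<in> \<Delta> \<longleftrightarrow> (\<forall>x. ?sub_aa (AtI x) \<and> ?F (AtI x) x \<and>
      (\<forall>t. ?sub_aa t \<longrightarrow> (?F t x \<longleftrightarrow> (\<forall>z. ?M z t \<longleftrightarrow> ?M z (AtI x)))) \<and>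
      (\<forall>y. ?F (AtI x) y \<longrightarrow> ?E x y))"
    by (simp add: Ax_at_ind_F_def truth iff_conv_conj_imp)
  then have "Ax_at_ind_F \<in> \<Delta>"
    using sub fus S.fusion_ati S.fusion_ati_unique by presburger
  moreover have "ATC1 \<in> \<Delta>"
  proof -
    have "ATC1 \<in> \<Delta> \<longleftrightarrow> (\<forall>x. \<exists>s. ?sub_aa s \<and> ?F s x \<and>
        (\<forall>t. ?sub_aa t \<longrightarrow> (?F t x \<longleftrightarrow> (\<forall>z. ?M z s \<longleftrightarrow> ?M z t))) \<and> (\<forall>y. ?F s y \<longrightarrow> ?E x y))"
      by (simp add: ATC1_def truth iff_conv_conj_imp)
    also have "\<dots>"
    \<comment> \<open>The plural required by \<open>ATC1\<close> is \<open>AtI x\<close>, which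
      instantiates the unknown left by \<open>exI\<close>.\<close>
    proof (rule allI, rule exI, intro conjI)
      fix x
      show "\<forall>z. ?M z (AtI x) \<longrightarrow> ?M z AA" "\<exists>z. ?M z (AtI x)" using sub by blast+
      show "?F (AtI x) x" by (rule S.fusion_ati)
      show "\<forall>t. ?sub_aa t \<longrightarrow> (?F t x \<longleftrightarrow> (\<forall>z. ?M z (AtI x) \<longleftrightarrow> ?M z t))" using fus by metis
      show "\<forall>y. ?F (AtI x) y \<longrightarrow> ?E x y" using S.fusion_ati_unique by blast
    qed
    finally show ?thesis .
  qed
  ultimately show ?thesis by (simp add: ATC_def)
qed

section \<open>Replacing the axioms of a derivation\<close>

text \<open>Closed formulas contain no eigenvariable, so every side condition survives with the same
  choice of variables.\<close>

lemma proves_weaken_closed: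
  assumes "\<Gamma> \<turnstile> \<phi>" "\<forall>\<gamma>\<in>T. ifree \<gamma> = {} \<and> pfree \<gamma> = {}"
  shows "\<Gamma> \<union> T \<turnstile> \<phi>"
  using assms
proof (induction rule: proves.induct)
  case (ImpE \<Gamma> \<phi> \<psi>)
  then show ?case by (blast intro: proves.ImpE)
next
  case (AndE1 \<Gamma> \<phi> \<psi>)
  then show ?case by (blast intro: proves.AndE1)
next
  case (AndE2 \<Gamma> \<phi> \<psi>)
  then show ?case by (blast intro: proves.AndE2)
next
  case (OrE \<Gamma> \<phi> \<psi> \<chi>)
  show ?case by (rule proves.OrE[of _ \<phi> \<psi>]) (use OrE in auto)
next
  case (AllI_I \<Gamma> x y \<phi>)
  show ?case by (rule proves.AllI_I[of _ x y]) (use AllI_I in auto)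
next
  case (AllP_I \<Gamma> u v \<phi>)
  show ?case by (rule proves.AllP_I[of _ u v]) (use AllP_I in auto)
next
  case (ExI_I \<Gamma> x y \<phi>)
  then show ?case by (blast intro: proves.ExI_I)
next
  case (ExP_I \<Gamma> u t \<phi>)
  then show ?case by (blast intro: proves.ExP_I)
next
  case (ExI_E \<Gamma> x \<phi> y \<psi>)
  show ?case by (rule proves.ExI_E[of _ x \<phi> y]) (use ExI_E in auto)
next
  case (ExP_E \<Gamma> u \<phi> v \<psi>)
  show ?case by (rule proves.ExP_E[of _ u \<phi> v]) (use ExP_E in auto)
next
  case (EqSubst \<Gamma> x y z \<phi>)
  then show ?case by (blast intro: proves.EqSubst)
qed (simp_all add: proves.Assm proves.ImpI proves.AndI proves.OrI1 proves.OrI2 proves.Class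
    proves.AllI_E proves.AllP_E proves.EqRefl)

text \<open>The members of \<Gamma> are discharged one at a time into implications; the derivation
  left without assumptions is weakened by the closed set \<open>T\<close>, and modus ponens restores
  \<phi>.\<close>

lemma proves_cut_closed:
  assumes "finite \<Gamma>" "\<Gamma> \<turnstile> \<phi>" "\<And>\<gamma>. \<gamma> \<in> \<Gamma> \<Longrightarrow> T \<turnstile> \<gamma>"
    and T: "\<forall>\<gamma>\<in>T. ifree \<gamma> = {} \<and> pfree \<gamma> = {}"
  shows "T \<turnstile> \<phi>"
  using assms(1-3)
proof (induction \<Gamma> arbitrary: \<phi> rule: finite_induct)
  case empty
  then show ?case using proves_weaken_closed[OF _ T, of "{}"] by simp
next
  case (insert \<gamma> \<Gamma>)
  then have "T \<turnstile> \<gamma> \<^bold>\<longrightarrow> \<phi>" by (blast intro: ImpI)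
  then show ?case using insert.prems(2) by (blast intro: ImpE)
qed

theorem theorem2:
  fixes \<phi> :: fm
  assumes "ATC \<union> {Df_P_F, Df_A_F} \<turnstile> \<phi>"
  shows "AEM_pl \<union> {Df_aa_P, Df_at_ind_P, Df_at_pl_P} \<turnstile> \<phi>"
proof (rule proves_cut_closed[OF _ assms])
  show "finite (ATC \<union> {Df_P_F, Df_A_F})" by (simp add: ATC_def)
  show "AEM_defs \<turnstile> \<gamma>" if "\<gamma> \<in> ATC \<union> {Df_P_F, Df_A_F}" for \<gamma>
  proof (rule saturated_completeness)
    show "finite AEM_defs" by (simp add: AEM_pl_def)
    show "\<gamma> \<in> \<Delta>" if "saturated 4 \<Delta>" "AEM_defs \<subseteq> \<Delta>" for \<Delta>
      using saturated_ATC[OF that] \<open>\<gamma> \<in> _\<close> by blast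
  qed
  show "\<forall>\<gamma>\<in>AEM_defs. ifree \<gamma> = {} \<and> pfree \<gamma> = {}"
    by (auto simp: AEM_pl_def P_refl_def P_trans_def P_antisym_def P_supplementation_def Df_A_def
        Df_F_def P_atomicity_def Df_aa_P_def Df_at_ind_P_def Df_at_pl_P_def Overlap_def Let_def)
qed

end
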